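(* For every integer $n \geq 2$, $$\lim_{k \to \infty} c_1\left(K_{2,n}^{\oslash k}\right) \;\geq\; 2 - \frac{2}{n}.$$
   Context: An $s$-$t$ graph is a graph $G$ with two distinguished vertices $s(G), t(G)$. Graphs carry edge lengths $\mathrm{len}$ and are viewed as metric spaces with the shortest-path metric. For $s$-$t$ graphs $H,G$ with edge lengths, $H \oslash G$ is the $s$-$t$ graph obtained by replacing each edge $e=(u,v)$ of $H$ by a new copy of $G$, with $s(G)$ identified with $u$ and $t(G)$ identified with $v$ (with respect to an arbitrary fixed orientation of the edges of $H$; for $G=K_{2,n}$ the orientation is irrelevant by symmetry). The edges of the copy of $G$ replacing $e$ have their $G$-lengths multiplied by $\mathrm{len}_H(e)/d_G(s(G),t(G))$, and $s(H\oslash G)=s(H)$, $t(H \oslash G)=t(H)$. $G^{\oslash 0}$ is a single edge of unit length (its endpoints being $s$ and $t$), and $G^{\oslash k} = G^{\oslash (k-1)} \oslash G$ for $k \ge 1$. $K_{2,n}$ is the complete bipartite graph with $2$ vertices on one side and $n$ on the other, with unit edge lengths; it is an $s$-$t$ graph whose vertices $s,t$ are the two vertices of the side of size 2. For a map $f:(X,d_X)\to(Y,d_Y)$ between metric spaces, $\|f\|_{\mathrm{Lip}} = \sup_{x\ne y} d_Y(f(x),f(y))/d_X(x,y)$, and for injective $f$ the distortion is $\mathrm{dist}(f)=\|f\|_{\mathrm{Lip}}\cdot\|f^{-1}\|_{\mathrm{Lip}}$ (and $\infty$ if $f$ is not injective). For a metric space $X$, $c_1(X)$ is the least distortion (infimum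 of $\mathrm{dist}(f)$) over maps $f: X\to L_1$. Here $c_1(K_{2,n}^{\oslash k})$ refers to the shortest-path metric on $V(K_{2,n}^{\oslash k})$ in which every edge of $K_{2,n}^{\oslash k}$ has length $2^{-k}$ (these are the lengths produced by the recursive definition of $K_{2,n}^{\oslash k}$, since $d_{K_{2,n}}(s,t)=2$). *)

theory Defs
  imports "HOL-Analysis.Analysis" "HOL-Library.Countable" "Graph_Theory.Shortest_Path"
    "Graph_Theory.Kuratowski"
begin

section \<open>Graphs with two distinguished vertices and edge lengths\<close>

text \<open>
  Every edge is recorded once, as an arc from one of its ends to the other. This is the fixed
  orientation along which copies of a graph are glued in; distances ignore it.
\<close>

record ('a, 'b) st_graph = "('a, 'b) pre_digraph" +
  src :: 'a
  snk :: 'a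
  len :: "'b \<Rightarrow> real"

text \<open>Each edge gives two arcs, the flag telling whether it is traversed backwards.\<close>

definition bidirect :: "('a, 'b) st_graph \<Rightarrow> ('a, 'b \<times> bool) pre_digraph" where
  "bidirect G =
    \<lparr>verts = verts G,
     arcs = arcs G \<times> UNIV,
     tail = (\<lambda>(e, r). if r then head G e else tail G e),
     head = (\<lambda>(e, r). if r then tail G e else head G e)\<rparr>"

definition gdist :: "('a, 'b) st_graph \<Rightarrow> 'a \<Rightarrow> 'a \<Rightarrow> real" where
  "gdist G u v = real_of_ereal (wf_digraph.\<mu> (bidirect G) (\<lambda>(e, r). len G e) u v)"

text \<open>
  In the product, \<open>Inl v\<close> is the vertex \<open>v\<close> of \<open>H\<close> and \<open>Inr (e, w)\<close> is the vertex \<open>w\<close> of the copy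
  of \<open>G\<close> that replaces \<open>e\<close>, for \<open>w\<close> different from the two distinguished vertices of \<open>G\<close>.
\<close>

definition copy_vertex ::
  "('a, 'b) st_graph \<Rightarrow> ('c, 'd) st_graph \<Rightarrow> 'b \<Rightarrow> 'c \<Rightarrow> 'a + 'b \<times> 'c" where
  "copy_vertex H G e w =
    (if w = src G then Inl (tail H e) else if w = snk G then Inl (head H e) else Inr (e, w))"

definition oslash ::
  "('a, 'b) st_graph \<Rightarrow> ('c, 'd) st_graph \<Rightarrow> ('a + 'b \<times> 'c, 'b \<times> 'd) st_graph"
  (infixl "\<oslash>" 70) where
  "H \<oslash> G =
    \<lparr>verts = Inl ` verts H \<union> Inr ` (arcs H \<times> (verts G - {src G, snk G})),
     arcs = arcs H \<times> arcs G,
     tail = (\<lambda>(e, f). copy_vertex H G e (tail G f)),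
     head = (\<lambda>(e, f). copy_vertex H G e (head G f)),
     src = Inl (src H),
     snk = Inl (snk H),
     len = (\<lambda>(e, f). len G f * (len H e / gdist G (src G) (snk G)))\<rparr>"

text \<open>
  The product changes the types of vertices and edges. To iterate it, both are renamed back to
  natural numbers along the injections \<^const>\<open>to_nat\<close>.
\<close>

definition nat_labelled ::
  "('a :: countable, 'b :: countable) st_graph \<Rightarrow> (nat, nat) st_graph" where
  "nat_labelled G =
    \<lparr>verts = to_nat ` verts G,
     arcs = to_nat ` arcs G,
     tail = (\<lambda>i. to_nat (tail G (from_nat i))),
     head = (\<lambda>i. to_nat (head G (from_nat i))),
     src = to_nat (src G),
     snk = to_nat (snk G),
     len = (\<lambda>i. len G (from_nat i))\<rparr>"

definition unit_edge :: "(nat, nat) st_graph" where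
  "unit_edge =
    \<lparr>verts = {0, 1}, arcs = {0}, tail = (\<lambda>_. 0), head = (\<lambda>_. 1), src = 0, snk = 1, len = (\<lambda>_. 1)\<rparr>"

primrec oslash_power ::
  "('c :: countable, 'd :: countable) st_graph \<Rightarrow> nat \<Rightarrow> (nat, nat) st_graph" where
  "oslash_power G 0 = unit_edge"
| "oslash_power G (Suc k) = nat_labelled (oslash_power G k \<oslash> G)"

text \<open>
  The side of size 2 is \<open>{Inl False, Inl True}\<close>; the edge \<open>(b, i)\<close> joins \<open>Inl b\<close> and \<open>Inr i\<close>.
\<close>

definition K2 :: "nat \<Rightarrow> (bool + nat, bool \<times> nat) st_graph" where
  "K2 n =
    \<lparr>verts = range Inl \<union> Inr ` {..<n},
     arcs = UNIV \<times> {..<n},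
     tail = (\<lambda>(b, i). if b then Inr i else Inl False),
     head = (\<lambda>(b, i). if b then Inl True else Inr i),
     src = Inl False,
     snk = Inl True,
     len = (\<lambda>_. 1)\<rparr>"

text \<open>
  The shortest-path function of the library is specified for well-formed digraphs only, so
  well-formedness is what makes \<^const>\<open>gdist\<close> meaningful.
\<close>

lemma wf_bidirect:
  assumes "\<And>e. e \<in> arcs G \<Longrightarrow> tail G e \<in> verts G \<and> head G e \<in> verts G"
  shows "wf_digraph (bidirect G)"
  using assms by unfold_locales (auto simp: bidirect_def split: if_splits)

lemma wf_K2: "wf_digraph (bidirect (K2 n))"
  by (rule wf_bidirect) (auto simp: K2_def split: if_splits)

lemma K2_complete_bipartite: "complete_bipartite_digraph 2 n (bidirect (K2 n))"
proof -
  interpret wf_digraph "bidirect (K2 n)" by (rule wf_K2)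
  have "graph (bidirect (K2 n))"
  proof unfold_locales
    show "finite (verts (bidirect (K2 n)))" "finite (arcs (bidirect (K2 n)))"
      by (simp_all add: bidirect_def K2_def)
    show "tail (bidirect (K2 n)) e \<noteq> head (bidirect (K2 n)) e" for e
      by (cases e) (auto simp: bidirect_def K2_def split: if_splits)
    show "e1 = e2" if "arc_to_ends (bidirect (K2 n)) e1 = arc_to_ends (bidirect (K2 n)) e2" for e1 e2
      using that
      by (cases e1; cases e2)
        (auto simp: arc_to_ends_def bidirect_def K2_def split: if_splits prod.splits)
    show "symmetric (bidirect (K2 n))"
      unfolding symmetric_def sym_def arcs_ends_def
    proof (intro allI impI)
      fix a b assume "(a, b) \<in> arc_to_ends (bidirect (K2 n)) ` arcs (bidirect (K2 n))"
      then obtain e r where "(e,r) \<in> arcs (bidirect (K2 n))" "(a, b) = arc_to_ends (bidirect (K2 n)) (e,r)" by auto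
      then show "(b, a) \<in> arc_to_ends (bidirect (K2 n)) ` arcs (bidirect (K2 n))"
        by (intro image_eqI[of _ _ "(e, \<not> r)"]) (auto simp: arc_to_ends_def bidirect_def split: if_splits)
    qed
  qed
  moreover have "\<exists>U V. verts (bidirect (K2 n)) = U \<union> V \<and> U \<inter> V = {} \<and> card U = 2 \<and> card V = n \<and>
    arcs_ends (bidirect (K2 n)) = U \<times> V \<union> V \<times> U"
  proof (intro exI conjI)
    let ?U = "range Inl :: (bool + nat) set" and ?V = "Inr ` {..<n} :: (bool + nat) set"
    show "verts (bidirect (K2 n)) = ?U \<union> ?V"
      by (simp add: bidirect_def K2_def)
    show "?U \<inter> ?V = {}"
      by auto
    show "card ?U = 2" "card ?V = n"
      by (simp_all add: card_image)
    have "arcs_ends (bidirect (K2 n)) = {(u, v). u \<in> ?U \<and> v \<in> ?V \<or> u \<in> ?V \<and> v \<in> ?U}"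
      by (auto simp: arcs_ends_def arc_to_ends_def bidirect_def K2_def image_iff split: if_splits)
         (auto simp: Bex_def split: if_splits)
    also have "\<dots> = ?U \<times> ?V \<union> ?V \<times> ?U"
      by blast
    finally show "arcs_ends (bidirect (K2 n)) = ?U \<times> ?V \<union> ?V \<times> ?U" .
  qed
  ultimately show ?thesis
    unfolding complete_bipartite_digraph_def by (rule conjI)
qed

lemma gdist_K2:
  assumes "n \<ge> 1"
  shows "gdist (K2 n) (src (K2 n)) (snk (K2 n)) = 2"
proof -
  let ?B = "bidirect (K2 n)"
  interpret wf_digraph ?B by (rule wf_K2)
  let ?w = "\<lambda>(e, r). len (K2 n) e"
  have B: "verts ?B = range Inl \<union> Inr ` {..<n}" "arcs ?B = (UNIV \<times> {..<n}) \<times> UNIV"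
    "tail ?B ((b, i), r) = (if r = b then Inl b else Inr i)"
    "head ?B ((b, i), r) = (if r = b then Inr i else Inl b)" for b i r
    by (auto simp: bidirect_def K2_def)
  have cost: "awalk_cost ?w p = length p" for p
    by (induct p) (auto simp: K2_def)
  have w: "awalk (Inl False) [((False, 0), False), ((True, 0), False)] (Inl True)"
    using assms by (auto simp: awalk_def B)
  have "2 \<le> length p" if "awalk (Inl False) p (Inl True)" for p
    using that by (cases p; cases "tl p") (auto simp: awalk_def B split: if_splits)
  then have "\<mu> ?w (Inl False) (Inl True) = ereal 2"
    unfolding \<mu>_def cost using w
    by (intro antisym INF_greatest INF_lower2[of "[((False, 0), False), ((True, 0), False)]"]) auto
  then show ?thesis by (simp add: gdist_def K2_def)
qed

lemma len_power:
  assumes "n \<ge> 1" "e \<in> arcs (oslash_power (K2 n) k)"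
  shows "len (oslash_power (K2 n) k) e = (1/2)^k"
  using assms(2)
proof (induct k arbitrary: e)
  case (Suc k)
  then show ?case
    using gdist_K2[OF assms(1)] Suc(1)
    by (auto simp: nat_labelled_def oslash_def) (simp add: K2_def)
qed (simp add: unit_edge_def)

lemma wf_power: "wf_digraph (bidirect (oslash_power (K2 n) k))"
proof (rule wf_bidirect, induct k)
  case (Suc k)
  then show ?case
    by (fastforce simp: nat_labelled_def oslash_def copy_vertex_def K2_def split: if_splits)
qed (auto simp: unit_edge_def)

section \<open>The space \<open>L\<^sub>1([0, 1])\<close>\<close>

definition L1_eq :: "(real \<Rightarrow> real) \<Rightarrow> (real \<Rightarrow> real) \<Rightarrow> bool" where
  "L1_eq f g \<longleftrightarrow> integrable (lebesgue_on {0..1}) f \<and> integrable (lebesgue_on {0..1}) g \<and>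
    (AE x in lebesgue_on {0..1}. f x = g x)"

quotient_type L1 = "real \<Rightarrow> real" / partial: L1_eq
proof (rule part_equivpI)
  show "\<exists>f. L1_eq f f"
    by (rule exI[of _ "\<lambda>_. 0"]) (simp add: L1_eq_def)
  show "symp L1_eq"
    by (auto simp: symp_def L1_eq_def)
  show "transp L1_eq"
    unfolding transp_def L1_eq_def by (auto elim: AE_mp)
qed

instantiation L1 :: metric_space
begin

lift_definition dist_L1 :: "L1 \<Rightarrow> L1 \<Rightarrow> real"
  is "\<lambda>f g. LINT x|lebesgue_on {0..1}. \<bar>f x - g x\<bar>"
  unfolding L1_eq_def by (intro integral_cong_AE) auto

definition uniformity_L1 :: "(L1 \<times> L1) filter" where
  "uniformity_L1 = (INF e\<in>{0<..}. principal {(x, y). dist x y < e})"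

definition open_L1 :: "L1 set \<Rightarrow> bool" where
  "open_L1 U \<longleftrightarrow> (\<forall>x\<in>U. \<forall>\<^sub>F (x', y) in uniformity. x' = x \<longrightarrow> y \<in> U)"

instance
proof
  fix x y z :: L1
  show "dist x y = 0 \<longleftrightarrow> x = y"
  proof (transfer, goal_cases)
    case (1 f g)
    then have "integrable (lebesgue_on {0..1}) (\<lambda>x. \<bar>f x - g x\<bar>)"
      by (auto simp: L1_eq_def)
    then have "(LINT x|lebesgue_on {0..1}. \<bar>f x - g x\<bar>) = 0 \<longleftrightarrow>
        (AE x in lebesgue_on {0..1}. \<bar>f x - g x\<bar> = 0)"
      by (intro integral_nonneg_eq_0_iff_AE) auto
    then show ?case using 1 by (simp add: L1_eq_def)
  qed
  show "dist x y \<le> dist x z + dist y z"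
  proof (transfer, goal_cases)
    case (1 f g h)
    then have i: "integrable (lebesgue_on {0..1}) (\<lambda>x. \<bar>f x - h x\<bar>)"
      "integrable (lebesgue_on {0..1}) (\<lambda>x. \<bar>g x - h x\<bar>)"
      "integrable (lebesgue_on {0..1}) (\<lambda>x. \<bar>f x - g x\<bar>)"
      by (auto simp: L1_eq_def)
    then have "(LINT x|lebesgue_on {0..1}. \<bar>f x - g x\<bar>) \<le>
        (LINT x|lebesgue_on {0..1}. \<bar>f x - h x\<bar> + \<bar>g x - h x\<bar>)"
      by (intro integral_mono) auto
    then show ?case using i by simp
  qed
qed (fact uniformity_L1_def open_L1_def)+

end

section \<open>Distortion\<close>

definition lip_norm ::
  "'a set \<Rightarrow> ('a \<Rightarrow> 'a \<Rightarrow> real) \<Rightarrow> ('b \<Rightarrow> 'b \<Rightarrow> real) \<Rightarrow> ('a \<Rightarrow> 'b) \<Rightarrow> ennreal" where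
  "lip_norm X dX dY f =
    (SUP (x, y)\<in>{(x, y). x \<in> X \<and> y \<in> X \<and> x \<noteq> y}. ennreal (dY (f x) (f y) / dX x y))"

definition distortion ::
  "'a set \<Rightarrow> ('a \<Rightarrow> 'a \<Rightarrow> real) \<Rightarrow> ('a \<Rightarrow> 'b :: metric_space) \<Rightarrow> ennreal" where
  "distortion X d f =
    (if inj_on f X then lip_norm X d dist f * lip_norm (f ` X) dist d (inv_into X f) else \<infinity>)"

definition c1 :: "'a set \<Rightarrow> ('a \<Rightarrow> 'a \<Rightarrow> real) \<Rightarrow> ennreal" where
  "c1 X d = (INF f :: 'a \<Rightarrow> L1. distortion X d f)"

end

theory Submission
  imports Defs
begin

text \<open>
  The inclusions of each iterate into the next are isometric, so the distortions increase with
  \<open>k\<close> and converge.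

  Suppose \<open>d \<le> D \<le> B d\<close> with \<open>B < 2 - 2 / n\<close>, where \<open>D\<close> is a rescaled pullback of the \<open>L\<^sub>1\<close>
  metric. In \<open>L\<^sub>1\<close> the points \<open>s, t, m\<^sub>1, \<dots>, m\<^sub>n\<close> satisfy
  \<open>\<Sum>\<^sub>i \<Sum>\<^sub>j D(m\<^sub>i, m\<^sub>j) \<le> n\<^sup>2 / 2 * D(s, t) + n * \<Sum>\<^sub>i (D(s, m\<^sub>i) + D(m\<^sub>i, t) - D(s, t))\<close>,
  while the midpoints replacing an edge \<open>st\<close> of length \<open>l\<close> are at mutual distance at least \<open>l\<close>.
  Hence some excess \<open>D(s, m\<^sub>i) + D(m\<^sub>i, t) - D(s, t)\<close> is at least
  \<open>\<delta> l\<close> with \<open>\<delta> = 1 - 1 / n - B / 2 > 0\<close>, and one of the two edges at \<open>m\<^sub>i\<close> has a ratio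
  \<open>D / d\<close> larger by \<open>\<delta>\<close> than that of \<open>st\<close>. Iterating, the ratio exceeds \<open>B\<close>.
\<close>

section \<open>Shortest-path distances in connected graphs with nonnegative lengths\<close>

lemma bidirect_simps [simp]:
  "verts (bidirect G) = verts G"
  "arcs (bidirect G) = arcs G \<times> UNIV"
  "tail (bidirect G) (e, r) = (if r then head G e else tail G e)"
  "head (bidirect G) (e, r) = (if r then tail G e else head G e)"
  by (simp_all add: bidirect_def)

text \<open>\<open>gdist\<close> passes through \<open>real_of_ereal\<close>, which sends infinite
  values to 0. Nonnegative lengths and connectedness keep \<open>\<mu>\<close> finite, so that
  \<open>gdist\<close> is the true distance.\<close>

locale connected_st_graph = wf_digraph "bidirect G" for G :: "('a, 'b) st_graph" +
  assumes len_nonneg: "e \<in> arcs G \<Longrightarrow> 0 \<le> len G e"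
    and connected: "u \<in> verts G \<Longrightarrow> v \<in> verts G \<Longrightarrow> \<exists>p. awalk u p v"
begin

abbreviation cost :: "('b \<times> bool) list \<Rightarrow> real" where
  "cost \<equiv> awalk_cost (\<lambda>(e, r). len G e)"

lemma tail_in_vertices: "e \<in> arcs G \<Longrightarrow> tail G e \<in> verts G"
  and head_in_vertices: "e \<in> arcs G \<Longrightarrow> head G e \<in> verts G"
  using wellformed[of "(e, False)"] by auto

lemma awalk_vertices:
  assumes "awalk u p v"
  shows "u \<in> verts G" "v \<in> verts G"
  using awalk_hd_in_verts[OF assms] awalk_last_in_verts[OF assms] by auto

lemma awalk_forward: "e \<in> arcs G \<Longrightarrow> awalk (tail G e) [(e, False)] (head G e)"
  and awalk_backward: "e \<in> arcs G \<Longrightarrow> awalk (head G e) [(e, True)] (tail G e)"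
  using tail_in_vertices head_in_vertices by (auto simp: awalk_def)

lemma ereal_gdist:
  assumes "u \<in> verts G" "v \<in> verts G"
  shows "ereal (gdist G u v) = \<mu> (\<lambda>(e, r). len G e) u v"
proof -
  obtain p where p: "awalk u p v"
    using connected[OF assms] by blast
  have "0 \<le> \<mu> (\<lambda>(e, r). len G e) u v"
    unfolding \<mu>_def using len_nonneg
    by (auto intro!: INF_greatest pos_cost_pos_awalk_cost )
  moreover have "\<mu> (\<lambda>(e, r). len G e) u v \<le> cost p"
    by (rule min_cost_le_walk_cost[OF p])
  ultimately have "\<bar>\<mu> (\<lambda>(e, r). len G e) u v\<bar> \<noteq> \<infinity>"
    by auto
  then show ?thesis
    by (simp add: gdist_def ereal_real)
qed

lemma gdist_le_cost:
  assumes "awalk u p v"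
  shows "gdist G u v \<le> cost p"
  using min_cost_le_walk_cost[OF assms, of "\<lambda>(e, r). len G e"] awalk_vertices[OF assms]
  by (simp flip: ereal_gdist)

lemma gdist_greatest:
  assumes "u \<in> verts G" "v \<in> verts G" "\<And>p. awalk u p v \<Longrightarrow> c \<le> cost p"
  shows "c \<le> gdist G u v"
proof -
  have "ereal c \<le> \<mu> (\<lambda>(e, r). len G e) u v"
    unfolding \<mu>_def using assms(3) by (auto intro!: INF_greatest)
  then show ?thesis
    by (simp flip: ereal_gdist[OF assms(1,2)])
qed

lemma gdist_nonneg: "u \<in> verts G \<Longrightarrow> v \<in> verts G \<Longrightarrow> 0 \<le> gdist G u v"
  by (rule gdist_greatest) (auto intro!: pos_cost_pos_awalk_cost len_nonneg )

lemma gdist_self: "u \<in> verts G \<Longrightarrow> gdist G u u = 0"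
  using gdist_le_cost[of u "[]" u] gdist_nonneg[of u u] by (auto simp: awalk_def)

lemma gdist_arc_le: "e \<in> arcs G \<Longrightarrow> gdist G (tail G e) (head G e) \<le> len G e"
  using gdist_le_cost[OF awalk_forward] by simp

lemma gdist_arc_lipschitz:
  assumes u: "u \<in> verts G" and e: "e \<in> arcs G"
  shows "\<bar>gdist G u (tail G e) - gdist G u (head G e)\<bar> \<le> len G e"
proof -
  have "gdist G u (head G e) - len G e \<le> cost p" if "awalk u p (tail G e)" for p
    using gdist_le_cost[OF awalk_appendI[OF that awalk_forward[OF e]]] by simp
  moreover have "gdist G u (tail G e) - len G e \<le> cost p" if "awalk u p (head G e)" for p
    using gdist_le_cost[OF awalk_appendI[OF that awalk_backward[OF e]]] by simp
  ultimately show ?thesis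
    using gdist_greatest[of u "tail G e" "gdist G u (head G e) - len G e"]
      gdist_greatest[of u "head G e" "gdist G u (tail G e) - len G e"]
      u tail_in_vertices[OF e] head_in_vertices[OF e] by fastforce
qed

text \<open>The increments of \<open>\<phi>\<close> telescope along any walk. This is the source of
  the lower bounds on distances below: each comes from a suitable 1-Lipschitz potential.\<close>

lemma potential_le_gdist:
  fixes \<phi> :: "'a \<Rightarrow> real"
  assumes lip: "\<And>e. e \<in> arcs G \<Longrightarrow> \<bar>\<phi> (tail G e) - \<phi> (head G e)\<bar> \<le> len G e"
    and "u \<in> verts G" "v \<in> verts G"
  shows "\<phi> v - \<phi> u \<le> gdist G u v"
proof (rule gdist_greatest[OF assms(2,3)])
  fix p assume "awalk u p v"
  then show "\<phi> v - \<phi> u \<le> cost p"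
  proof (induct p arbitrary: u)
    case Nil
    then show ?case by (simp add: awalk_Nil_iff)
  next
    case (Cons a p)
    obtain e r where a: "a = (e, r)" by fastforce
    have "e \<in> arcs G" and "u = (if r then head G e else tail G e)"
      and "awalk (if r then tail G e else head G e) p v"
      using Cons.prems by (auto simp: a awalk_Cons_iff split: if_splits)
    with Cons.hyps[of "if r then tail G e else head G e"] lip[of e]
    show ?case by (auto simp: a split: if_splits)
  qed
qed

lemma min_len_le_gdist:
  assumes "\<And>e. e \<in> arcs G \<Longrightarrow> l \<le> len G e" "0 \<le> l" "u \<in> verts G" "v \<in> verts G" "u \<noteq> v"
  shows "l \<le> gdist G u v"
proof -
  \<comment> \<open>The potential is 0 at \<open>u\<close> and \<open>l\<close> elsewhere, so it
    changes by at most \<open>l\<close> along any edge.\<close>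
  have "(if v = u then 0 else l) - (if u = u then 0 else l) \<le> gdist G u v"
    using assms len_nonneg
    by (intro potential_le_gdist[of "\<lambda>x. if x = u then 0 else l"]) auto
  with assms show ?thesis by simp
qed

end

section \<open>One replacement step with \<open>K2 n\<close>\<close>

text \<open>
  After relabelling, \<open>old v\<close> is the vertex \<open>v\<close> of \<open>H\<close>, \<open>mid e i\<close> is the \<open>i\<close>-th midpoint placed
  on the edge \<open>e\<close>, and \<open>half e b i\<close> joins it to the tail or, if \<open>b\<close> holds, the head of \<open>e\<close>.
\<close>

definition old :: "nat \<Rightarrow> nat" where
  "old v = to_nat (Inl v :: nat + nat \<times> (bool + nat))"

definition mid :: "nat \<Rightarrow> nat \<Rightarrow> nat" where
  "mid e i = to_nat (Inr (e, Inr i) :: nat + nat \<times> (bool + nat))"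

definition half :: "nat \<Rightarrow> bool \<Rightarrow> nat \<Rightarrow> nat" where
  "half e b i = to_nat (e, (b, i))"

text \<open>Isolates one iteration over an arbitrary \<open>H\<close>, so that the metric facts need
  no induction on the exponent.\<close>

definition K2_step :: "nat \<Rightarrow> (nat, nat) st_graph \<Rightarrow> (nat, nat) st_graph" where
  "K2_step n H = nat_labelled (H \<oslash> K2 n)"

lemma old_mid_eq [simp]:
  "old u = old v \<longleftrightarrow> u = v" "mid e i = mid e' j \<longleftrightarrow> e = e' \<and> i = j"
  "old u \<noteq> mid e i" "mid e i \<noteq> old u"
  by (auto simp: old_def mid_def)

lemma mid_notin_range_old [simp]: "mid e i \<notin> range old"
  by auto

lemma verts_K2_step:
  "verts (K2_step n H) = old ` verts H \<union> {mid e i |e i. e \<in> arcs H \<and> i < n}"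
proof -
  have "verts (K2 n) - {src (K2 n), snk (K2 n)} = Inr ` {..<n}"
    by (auto simp: K2_def)
  then show ?thesis
    by (force simp: K2_step_def nat_labelled_def oslash_def old_def mid_def image_Un image_image)
qed

lemma arcs_K2_step: "arcs (K2_step n H) = {half e b i |e b i. e \<in> arcs H \<and> i < n}"
  by (force simp: K2_step_def nat_labelled_def oslash_def half_def K2_def)

lemma tail_K2_step: "tail (K2_step n H) (half e b i) = (if b then mid e i else old (tail H e))"
  and head_K2_step: "head (K2_step n H) (half e b i) = (if b then old (head H e) else mid e i)"
  by (auto simp: K2_step_def nat_labelled_def oslash_def half_def old_def mid_def copy_vertex_def K2_def)

text \<open>The factor 1/2 is the reciprocal of the distance 2 between the distinguished vertices of
  \<open>K2 n\<close>.\<close>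

lemma len_K2_step: "n \<ge> 1 \<Longrightarrow> len (K2_step n H) (half e b i) = len H e / 2"
  using gdist_K2[of n] by (simp add: K2_step_def nat_labelled_def oslash_def half_def) (simp add: K2_def)

text \<open>Every arc of the walk is replaced by the two halves through midpoint 0, which exists
  because \<open>n \<ge> 1\<close>.\<close>

lemma awalk_K2_step:
  assumes n: "n \<ge> 1" and H: "connected_st_graph H" and wf: "wf_digraph (bidirect (K2_step n H))"
    and "pre_digraph.awalk (bidirect H) u p v"
  shows "\<exists>q. pre_digraph.awalk (bidirect (K2_step n H)) (old u) q (old v) \<and>
    wf_digraph.awalk_cost (\<lambda>(e, r). len (K2_step n H) e) q =
      wf_digraph.awalk_cost (\<lambda>(e, r). len H e) p"
proof -
  interpret H: connected_st_graph H by (rule H)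
  interpret S: wf_digraph "bidirect (K2_step n H)" by (rule wf)
  from assms(4) show ?thesis
  proof (induct p arbitrary: u)
    case Nil
    then show ?case
      by (intro exI[of _ "[]"]) (auto simp: H.awalk_Nil_iff S.awalk_Nil_iff verts_K2_step)
  next
    case (Cons a p)
    obtain e r where a: "a = (e, r)" by fastforce
    have e: "e \<in> arcs H" and u: "u = (if r then head H e else tail H e)"
      and w: "H.awalk (if r then tail H e else head H e) p v"
      using Cons.prems by (auto simp: a H.awalk_Cons_iff split: if_splits)
    obtain q where q: "S.awalk (old (if r then tail H e else head H e)) q (old v)"
      "S.awalk_cost (\<lambda>(e, r). len (K2_step n H) e) q = H.awalk_cost (\<lambda>(e, r). len H e) p"
      using Cons.hyps[OF w] by blast
    have arc: "half e b 0 \<in> arcs (K2_step n H)" for b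
      using e n by (force simp: arcs_K2_step)
    show ?case
      \<comment> \<open>A backward traversal (\<open>r\<close> true) starts at the head, so it meets
        the head half first; thus \<open>half e r 0\<close> comes first in both directions.\<close>
      by (rule exI[of _ "(half e r 0, r) # (half e (\<not> r) 0, r) # q"])
        (use q arc n in \<open>auto simp: u a S.awalk_Cons_iff tail_K2_step head_K2_step len_K2_step
          split: if_splits\<close>)
  qed
qed

text \<open>Each new vertex is linked to and from an old one, and walks between old vertices are
  transported from \<open>H\<close>.\<close>

lemma connected_K2_step:
  assumes n: "n \<ge> 1" and H: "connected_st_graph H"
  shows "connected_st_graph (K2_step n H)"
proof -
  interpret H: connected_st_graph H by (rule H)
  have wf: "wf_digraph (bidirect (K2_step n H))"
    using H.tail_in_vertices H.head_in_vertices
    by (intro wf_bidirect) (auto simp: arcs_K2_step verts_K2_step tail_K2_step head_K2_step)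
  interpret S: wf_digraph "bidirect (K2_step n H)" by (rule wf)
  have from_old: "\<exists>p. S.awalk (old u) p x" if u: "u \<in> verts H" and x: "x \<in> verts (K2_step n H)" for u x
  proof -
    have "\<exists>v p. v \<in> verts H \<and> S.awalk (old v) p x"
      using x unfolding verts_K2_step
    proof (elim UnE imageE)
      fix v assume "v \<in> verts H" "x = old v"
      then have "v \<in> verts H \<and> S.awalk (old v) [] x"
        by (auto simp: S.awalk_Nil_iff verts_K2_step)
      then show ?thesis by blast
    next
      assume "x \<in> {mid e i |e i. e \<in> arcs H \<and> i < n}"
      then obtain e i where "e \<in> arcs H" "i < n" "x = mid e i" by blast
      then have "tail H e \<in> verts H \<and> S.awalk (old (tail H e)) [(half e False i, False)] x"
        using H.tail_in_vertices
        by (auto simp: S.awalk_Cons_iff S.awalk_Nil_iff verts_K2_step arcs_K2_step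
            tail_K2_step head_K2_step)
      then show ?thesis by blast
    qed
    then obtain v p where v: "v \<in> verts H" "S.awalk (old v) p x" by blast
    obtain q where "S.awalk (old u) q (old v)"
      using H.connected[OF u v(1)] awalk_K2_step[OF n H wf] by blast
    then show ?thesis
      using S.awalk_appendI v(2) by blast
  qed
  have to_old: "\<exists>u p. u \<in> verts H \<and> S.awalk x p (old u)" if "x \<in> verts (K2_step n H)" for x
  proof -
    from that consider (old) v where "v \<in> verts H" "x = old v"
      | (mid) e i where "e \<in> arcs H" "i < n" "x = mid e i"
      by (auto simp: verts_K2_step)
    then show ?thesis
    proof cases
      case old
      then have "S.awalk x [] (old v)"
        by (auto simp: S.awalk_Nil_iff verts_K2_step)
      with old show ?thesis by blast
    next
      case mid
      then have "S.awalk x [(half e False i, True)] (old (tail H e))"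
        using H.tail_in_vertices
        by (auto simp: S.awalk_Cons_iff S.awalk_Nil_iff verts_K2_step arcs_K2_step
            tail_K2_step head_K2_step)
      with mid H.tail_in_vertices show ?thesis by blast
    qed
  qed
  show ?thesis
  proof unfold_locales
    show "0 \<le> len (K2_step n H) e" if "e \<in> arcs (K2_step n H)" for e
      using that H.len_nonneg n by (auto simp: arcs_K2_step len_K2_step)
    show "\<exists>p. S.awalk x p y" if "x \<in> verts (K2_step n H)" "y \<in> verts (K2_step n H)" for x y
      using to_old[OF that(1)] from_old[OF _ that(2)] S.awalk_appendI by blast
  qed
qed

text \<open>Transported walks give one inequality. For the other, the distance from \<open>u\<close>
  is extended to a 1-Lipschitz potential on the midpoints.\<close>

lemma gdist_K2_step_old:
  assumes n: "n \<ge> 1" and H: "connected_st_graph H" and u: "u \<in> verts H" and v: "v \<in> verts H"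
  shows "gdist (K2_step n H) (old u) (old v) = gdist H u v"
proof (rule antisym)
  interpret H: connected_st_graph H by (rule H)
  interpret S: connected_st_graph "K2_step n H" by (rule connected_K2_step[OF n H])
  show "gdist (K2_step n H) (old u) (old v) \<le> gdist H u v"
    using awalk_K2_step[OF n H S.wf_digraph_axioms] S.gdist_le_cost
    by (intro H.gdist_greatest[OF u v]) metis
  \<comment> \<open>The values at the two ends of \<open>e\<close> differ by at most
    \<open>len H e\<close>, so their minimum plus \<open>len H e / 2\<close> is within
    \<open>len H e / 2\<close> of both.\<close>
  define \<phi> where "\<phi> x = (if x \<in> range old then gdist H u (inv old x)
    else (case from_nat x :: nat + nat \<times> (bool + nat) of
        Inr (e, _) \<Rightarrow> min (gdist H u (tail H e)) (gdist H u (head H e)) + len H e / 2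
      | Inl _ \<Rightarrow> 0))" for x
  have "inj old" by (simp add: inj_on_def)
  then have \<phi>_old: "\<phi> (old x) = gdist H u x" for x
    by (simp add: \<phi>_def)
  have \<phi>_mid: "\<phi> (mid e i) = min (gdist H u (tail H e)) (gdist H u (head H e)) + len H e / 2" for e i
    by (simp add: \<phi>_def) (simp add: mid_def)
  have close: "\<bar>min x y + l / 2 - x\<bar> \<le> l / 2" "\<bar>min x y + l / 2 - y\<bar> \<le> l / 2"
    if "\<bar>x - y\<bar> \<le> l" for x y l :: real
    using that by linarith+
  have "\<phi> (old v) - \<phi> (old u) \<le> gdist (K2_step n H) (old u) (old v)"
  proof (rule S.potential_le_gdist)
    fix a assume "a \<in> arcs (K2_step n H)"
    then obtain e b i where "e \<in> arcs H" "a = half e b i"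
      by (auto simp: arcs_K2_step)
    with close[OF H.gdist_arc_lipschitz[OF u, of e]] n
    show "\<bar>\<phi> (tail (K2_step n H) a) - \<phi> (head (K2_step n H) a)\<bar> \<le> len (K2_step n H) a"
      by (cases b) (simp_all add: tail_K2_step head_K2_step len_K2_step \<phi>_old \<phi>_mid abs_minus_commute)
  qed (auto simp: verts_K2_step u v)
  then show "gdist H u v \<le> gdist (K2_step n H) (old u) (old v)"
    by (simp add: \<phi>_old H.gdist_self[OF u])
qed

lemma gdist_K2_step_mid:
  assumes n: "n \<ge> 1" and H: "connected_st_graph H"
    and len: "\<And>e. e \<in> arcs H \<Longrightarrow> len H e = l"
    and e: "e \<in> arcs H" "i < n" "j < n" "i \<noteq> j"
  shows "l \<le> gdist (K2_step n H) (mid e i) (mid e j)"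
proof -
  interpret H: connected_st_graph H by (rule H)
  interpret S: connected_st_graph "K2_step n H" by (rule connected_K2_step[OF n H])
  \<comment> \<open>Every arc joins a midpoint to an old vertex, so this potential changes by
    exactly \<open>l / 2\<close>, the common length of the new arcs.\<close>
  define \<phi> where "\<phi> x = (if x = mid e i then 0 else if x \<in> range old then l / 2 else l)" for x
  have "\<phi> (mid e j) - \<phi> (mid e i) \<le> gdist (K2_step n H) (mid e i) (mid e j)"
  proof (rule S.potential_le_gdist)
    fix a assume "a \<in> arcs (K2_step n H)"
    then obtain e' b i' where "e' \<in> arcs H" "a = half e' b i'"
      by (auto simp: arcs_K2_step)
    with H.len_nonneg[OF e(1)] n
    show "\<bar>\<phi> (tail (K2_step n H) a) - \<phi> (head (K2_step n H) a)\<bar> \<le> len (K2_step n H) a"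
      by (auto simp: tail_K2_step head_K2_step len_K2_step \<phi>_def len e(1))
  qed (use e in \<open>auto simp: verts_K2_step\<close>)
  then show ?thesis
    using e by (simp add: \<phi>_def)
qed

lemma connected_oslash_power:
  assumes "n \<ge> 1"
  shows "connected_st_graph (oslash_power (K2 n) k)"
proof (induct k)
  case 0
  interpret wf_digraph "bidirect unit_edge"
    by (rule wf_bidirect) (auto simp: unit_edge_def)
  have "awalk u (if u = v then [] else [(0, u = 1)]) v"
    if "u \<in> verts unit_edge" "v \<in> verts unit_edge" for u v
    using that
    by (auto simp: unit_edge_def pre_digraph.awalk_def pre_digraph.cas.simps)
  then show ?case
    by (simp, unfold_locales) (auto simp: unit_edge_def)
next
  case (Suc k)
  then show ?case
    using connected_K2_step[OF assms] by (simp add: K2_step_def)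
qed

section \<open>The inequality for \<open>K2 n\<close> on the line and in \<open>L1\<close>\<close>

text \<open>Inside the segment from \<open>s\<close> to \<open>t\<close> the sum of pairwise
  distances is largest when half of the points sit at each end. Points outside are projected to the
  segment, and the projection error \<open>e i\<close> is half of the excess of
  \<open>m i\<close>.\<close>

lemma real_K2_inequality:
  fixes s t :: real and m :: "nat \<Rightarrow> real"
  shows "(\<Sum>i<n. \<Sum>j<n. \<bar>m i - m j\<bar>) \<le>
    (real n)\<^sup>2 / 2 * \<bar>s - t\<bar> + real n * (\<Sum>i<n. \<bar>s - m i\<bar> + \<bar>m i - t\<bar> - \<bar>s - t\<bar>)"
proof -
  define L where "L = \<bar>s - t\<bar>"
  define x where "x i = max 0 (min L (m i - min s t))" for i
  define e where "e i = (\<bar>s - m i\<bar> + \<bar>m i - t\<bar> - \<bar>s - t\<bar>) / 2" for i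
  have x: "0 \<le> x i" "x i \<le> L" for i
    by (auto simp: x_def L_def)
  \<comment> \<open>\<open>x i + min s t\<close> is the projection of \<open>m i\<close> to the segment from \<open>s\<close> to \<open>t\<close>, at distance \<open>e i\<close>.\<close>
  have m: "\<bar>m i - m j\<bar> \<le> \<bar>x i - x j\<bar> + (e i + e j)" for i j
  proof -
    have "\<bar>m i - min s t - x i\<bar> \<le> e i" for i
      by (cases "s \<le> t"; cases "m i \<le> s"; cases "m i \<le> t")
        (simp_all add: x_def L_def e_def min_def max_def)
    from this[of i] this[of j] show ?thesis by linarith
  qed
  have X: "(\<Sum>i<n. \<Sum>j<n. \<bar>x i - x j\<bar>) \<le> (real n)\<^sup>2 / 2 * L"
  proof (cases "L = 0")
    case True
    then have "x i = 0" for i using x[of i] by simp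
    then show ?thesis using True by simp
  next
    case False
    then have L: "L > 0" by (simp add: L_def)
    define S where "S = (\<Sum>i<n. x i)"
    \<comment> \<open>With \<open>p = x i / L\<close> and \<open>q = x j / L\<close> this reads
      \<open>\<bar>p - q\<bar> \<le> p (1 - q) + q (1 - p)\<close>, where the right side is the
      probability that independent events of probabilities \<open>p\<close> and \<open>q\<close>
      disagree.\<close>
    have pt: "\<bar>x i - x j\<bar> * L \<le> x i * (L - x j) + x j * (L - x i)" for i j
    proof (cases "x i \<le> x j")
      case True
      have "0 \<le> x i * (L - x j)" using x by simp
      with True show ?thesis by (simp add: algebra_simps)
    next
      case False
      have "0 \<le> x j * (L - x i)" using x by simp
      with False show ?thesis by (simp add: algebra_simps)
    qed
    have "(\<Sum>i<n. \<Sum>j<n. \<bar>x i - x j\<bar>) * L = (\<Sum>i<n. \<Sum>j<n. \<bar>x i - x j\<bar> * L)"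
      by (simp add: sum_distrib_right)
    also have "\<dots> \<le> (\<Sum>i<n. \<Sum>j<n. x i * (L - x j) + x j * (L - x i))"
      by (intro sum_mono pt)
    also have "\<dots> = 2 * (S * (real n * L - S))"
    proof -
      have "(\<Sum>i<n. \<Sum>j<n. x i * (L - x j)) = S * (real n * L - S)"
        by (simp add: S_def sum_product sum_subtractf flip: sum_distrib_left sum_distrib_right)
      moreover have "(\<Sum>i<n. \<Sum>j<n. x j * (L - x i)) = (\<Sum>i<n. \<Sum>j<n. x i * (L - x j))"
        by (rule sum.swap)
      ultimately show ?thesis by (simp add: sum.distrib)
    qed
    \<comment> \<open>The product \<open>S * (real n * L - S)\<close> is largest at
      \<open>S = real n * L / 2\<close>.\<close>
    also have "\<dots> \<le> (real n)\<^sup>2 / 2 * L * L"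
      using zero_le_power2[of "2 * S - real n * L"] by (simp add: power2_eq_square algebra_simps)
    finally show ?thesis using L by simp
  qed
  have "(\<Sum>i<n. \<Sum>j<n. \<bar>m i - m j\<bar>) \<le> (\<Sum>i<n. \<Sum>j<n. \<bar>x i - x j\<bar> + (e i + e j))"
    by (intro sum_mono m)
  also have "\<dots> = (\<Sum>i<n. \<Sum>j<n. \<bar>x i - x j\<bar>) + real n * (\<Sum>i<n. 2 * e i)"
    by (simp add: sum.distrib sum_distrib_left mult.left_commute)
  also have "(\<Sum>i<n. 2 * e i) = (\<Sum>i<n. \<bar>s - m i\<bar> + \<bar>m i - t\<bar> - \<bar>s - t\<bar>)"
    by (simp only: e_def mult_2 field_sum_of_halves)
  finally show ?thesis
    using X unfolding L_def by linarith
qed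

lemma integrable_rep_L1: "integrable (lebesgue_on {0..1}) (rep_L1 p)"
  using Quotient_rep_reflp[OF Quotient_L1, of p] by (simp add: L1_eq_def)

lemma dist_L1_rep: "dist p q = (LINT x|lebesgue_on {0..1}. \<bar>rep_L1 p x - rep_L1 q x\<bar>)"
  using dist_L1.abs_eq[OF Quotient_rep_reflp[OF Quotient_L1] Quotient_rep_reflp[OF Quotient_L1], of p q]
  by (simp add: Quotient_abs_rep[OF Quotient_L1])

text \<open>The inequality on the line is linear in the distances, so it can be applied pointwise to
  representatives and integrated.\<close>

lemma L1_K2_inequality:
  fixes s t :: L1 and m :: "nat \<Rightarrow> L1"
  shows "(\<Sum>i<n. \<Sum>j<n. dist (m i) (m j)) \<le>
    (real n)\<^sup>2 / 2 * dist s t + real n * (\<Sum>i<n. dist s (m i) + dist (m i) t - dist s t)"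
proof -
  let ?M = "lebesgue_on {0..1::real}"
  have i: "integrable ?M (\<lambda>x. \<bar>rep_L1 p x - rep_L1 q x\<bar>)" for p q
    using integrable_rep_L1 by auto
  have "(LINT x|?M. (\<Sum>i<n. \<Sum>j<n. \<bar>rep_L1 (m i) x - rep_L1 (m j) x\<bar>)) \<le>
    (LINT x|?M. (real n)\<^sup>2 / 2 * \<bar>rep_L1 s x - rep_L1 t x\<bar> +
      real n * (\<Sum>i<n. \<bar>rep_L1 s x - rep_L1 (m i) x\<bar> + \<bar>rep_L1 (m i) x - rep_L1 t x\<bar> - \<bar>rep_L1 s x - rep_L1 t x\<bar>))"
    by (intro integral_mono real_K2_inequality Bochner_Integration.integrable_sum
        Bochner_Integration.integrable_add Bochner_Integration.integrable_diff integrable_mult_right i)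
  then show ?thesis
    by (simp add: dist_L1_rep i)
qed

section \<open>Growth of the stretch along the iteration\<close>

text \<open>The rescaled metric \<open>D\<close> is \<open>b * dist (f x) (f y)\<close>. If all
  halves fell short of the bound, all excesses would be below \<open>l * \<delta>\<close>, and the
  \<open>L1\<close> inequality would force the midpoints of \<open>e\<close> too close
  together.\<close>

lemma K2_step_steeper_arc:
  fixes f :: "nat \<Rightarrow> L1"
  assumes n: "n \<ge> 1" and H: "connected_st_graph H"
    and len: "\<And>e. e \<in> arcs H \<Longrightarrow> len H e = l" and e: "e \<in> arcs H"
    and "0 \<le> B" "0 \<le> b"
    and lower: "\<And>x y. x \<in> verts (K2_step n H) \<Longrightarrow> y \<in> verts (K2_step n H) \<Longrightarrow> x \<noteq> y \<Longrightarrow>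
      gdist (K2_step n H) x y \<le> b * dist (f x) (f y)"
    and upper: "\<And>x y. x \<in> verts (K2_step n H) \<Longrightarrow> y \<in> verts (K2_step n H) \<Longrightarrow> x \<noteq> y \<Longrightarrow>
      b * dist (f x) (f y) \<le> B * gdist (K2_step n H) x y"
  shows "\<exists>a\<in>arcs (K2_step n H).
    (b * dist (f (old (tail H e))) (f (old (head H e))) + l * (1 - 1 / n - B / 2)) / 2 \<le>
    b * dist (f (tail (K2_step n H) a)) (f (head (K2_step n H) a))"
proof (rule ccontr)
  assume neg: "\<not> ?thesis"
  interpret H: connected_st_graph H by (rule H)
  define s t \<delta> where "s = old (tail H e)" and "t = old (head H e)" and "\<delta> = 1 - 1 / n - B / 2"
  let ?D = "\<lambda>x y. b * dist (f x) (f y)"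
  have "s \<in> verts (K2_step n H)" "t \<in> verts (K2_step n H)"
    using H.tail_in_vertices[OF e] H.head_in_vertices[OF e] by (auto simp: s_def t_def verts_K2_step)
  have gst: "gdist (K2_step n H) s t \<le> l"
    using gdist_K2_step_old[OF n H H.tail_in_vertices[OF e] H.head_in_vertices[OF e]]
      H.gdist_arc_le[OF e] len[OF e] by (simp add: s_def t_def)
  \<comment> \<open>\<open>upper\<close> speaks of distinct vertices only, so the case that
    \<open>e\<close> is a loop is treated apart.\<close>
  have Dst: "?D s t \<le> B * l"
  proof (cases "s = t")
    case True
    then show ?thesis using \<open>0 \<le> B\<close> H.len_nonneg[OF e] len[OF e] by simp
  next
    case False
    then have "?D s t \<le> B * gdist (K2_step n H) s t"
      by (rule upper[rotated 2]) fact+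
    also have "\<dots> \<le> B * l"
      using gst \<open>0 \<le> B\<close> by (rule mult_left_mono)
    finally show ?thesis .
  qed
  have "?D s (mid e i) + ?D (mid e i) t - ?D s t < l * \<delta>" if "i < n" for i
  proof -
    have "half e False i \<in> arcs (K2_step n H)" "half e True i \<in> arcs (K2_step n H)"
      using e that by (auto simp: arcs_K2_step)
    then have "\<not> (?D s t + l * \<delta>) / 2 \<le> ?D s (mid e i)" "\<not> (?D s t + l * \<delta>) / 2 \<le> ?D (mid e i) t"
      using neg by (auto simp: tail_K2_step head_K2_step s_def t_def \<delta>_def
          dest: bspec[of _ _ "half e False i"] bspec[of _ _ "half e True i"])
    then show ?thesis by simp
  qed
  then have "(\<Sum>i<n. ?D s (mid e i) + ?D (mid e i) t - ?D s t) < (\<Sum>i<n. l * \<delta>)"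
    using n by (intro sum_strict_mono) (auto simp: lessThan_empty_iff)
  then have ex: "(\<Sum>i<n. ?D s (mid e i) + ?D (mid e i) t - ?D s t) < n * (l * \<delta>)"
    by simp
  \<comment> \<open>Only the off-diagonal ordered pairs count; the \<open>if\<close> removes the
    diagonal.\<close>
  have "n * ((n - 1) * l) = (\<Sum>i<n. \<Sum>j<n. l - (if j = i then l else 0))"
    using n by (simp add: sum_subtractf of_nat_diff algebra_simps)
  also have "\<dots> \<le> (\<Sum>i<n. \<Sum>j<n. ?D (mid e i) (mid e j))"
  proof (intro sum_mono)
    fix i j assume ij: "i \<in> {..<n}" "j \<in> {..<n}"
    show "l - (if j = i then l else 0) \<le> ?D (mid e i) (mid e j)"
    proof (cases "i = j")
      case False
      then have "l \<le> gdist (K2_step n H) (mid e i) (mid e j)"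
        using ij by (intro gdist_K2_step_mid[OF n H len e]) auto
      also have "\<dots> \<le> ?D (mid e i) (mid e j)"
        using ij False e by (intro lower) (auto simp: verts_K2_step)
      finally show ?thesis using False by simp
    qed simp
  qed
  also have "\<dots> = b * (\<Sum>i<n. \<Sum>j<n. dist (f (mid e i)) (f (mid e j)))"
    by (simp add: sum_distrib_left)
  also have "\<dots> \<le> b * ((real n)\<^sup>2 / 2 * dist (f s) (f t) + real n *
      (\<Sum>i<n. dist (f s) (f (mid e i)) + dist (f (mid e i)) (f t) - dist (f s) (f t)))"
    using \<open>0 \<le> b\<close> by (intro mult_left_mono L1_K2_inequality)
  also have "\<dots> = (real n)\<^sup>2 / 2 * ?D s t + real n * (\<Sum>i<n. ?D s (mid e i) + ?D (mid e i) t - ?D s t)"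
    by (simp add: algebra_simps sum_distrib_left)
  also have "\<dots> < (real n)\<^sup>2 / 2 * (B * l) + real n * (n * (l * \<delta>))"
    using n Dst ex by (intro add_le_less_mono mult_left_mono mult_strict_left_mono) auto
  \<comment> \<open>\<open>\<delta>\<close> is chosen so that
    \<open>B / 2 + \<delta> = 1 - 1 / n\<close>; the chain then closes on its own starting value
    with one strict step.\<close>
  also have "\<dots> = n * ((n - 1) * l)"
    using n by (simp add: \<delta>_def field_simps power2_eq_square of_nat_diff)
  finally show False by simp
qed

text \<open>Edges of the iterate have length \<open>(1 / 2) ^ k\<close>, so the claim is a stretch
  of at least \<open>k * \<delta>\<close> on some edge: each level gains
  \<open>\<delta>\<close>.\<close>

lemma oslash_power_steep_arc:
  fixes f :: "nat \<Rightarrow> L1"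
  assumes n: "n \<ge> 1" and "0 \<le> B" "0 \<le> b"
    and "\<And>x y. x \<in> verts (oslash_power (K2 n) k) \<Longrightarrow> y \<in> verts (oslash_power (K2 n) k) \<Longrightarrow> x \<noteq> y \<Longrightarrow>
      gdist (oslash_power (K2 n) k) x y \<le> b * dist (f x) (f y)"
    and "\<And>x y. x \<in> verts (oslash_power (K2 n) k) \<Longrightarrow> y \<in> verts (oslash_power (K2 n) k) \<Longrightarrow> x \<noteq> y \<Longrightarrow>
      b * dist (f x) (f y) \<le> B * gdist (oslash_power (K2 n) k) x y"
  shows "\<exists>a\<in>arcs (oslash_power (K2 n) k).
    (1 / 2) ^ k * (real k * (1 - 1 / n - B / 2)) \<le>
    b * dist (f (tail (oslash_power (K2 n) k) a)) (f (head (oslash_power (K2 n) k) a))"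
  using assms(4,5)
proof (induct k arbitrary: f)
  case 0
  then show ?case using \<open>0 \<le> b\<close> by (simp add: unit_edge_def)
next
  case (Suc k)
  let ?H = "oslash_power (K2 n) k" and ?\<delta> = "1 - 1 / n - B / 2"
  have H: "connected_st_graph ?H"
    by (rule connected_oslash_power[OF n])
  have S: "oslash_power (K2 n) (Suc k) = K2_step n ?H"
    by (simp add: K2_step_def)
  note lower = Suc.prems(1)[unfolded S] and upper = Suc.prems(2)[unfolded S]
  \<comment> \<open>Since \<open>old\<close> is isometric, \<open>f \<circ> old\<close> inherits
    both bounds; this is why \<open>f\<close> is generalised in the induction.\<close>
  have "\<exists>e\<in>arcs ?H. (1 / 2) ^ k * (real k * ?\<delta>) \<le>
    b * dist ((f \<circ> old) (tail ?H e)) ((f \<circ> old) (head ?H e))"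
  proof (rule Suc.hyps)
    fix x y assume xy: "x \<in> verts ?H" "y \<in> verts ?H" "x \<noteq> y"
    then have V: "old x \<in> verts (K2_step n ?H)" "old y \<in> verts (K2_step n ?H)" "old x \<noteq> old y"
      by (auto simp: verts_K2_step)
    show "gdist ?H x y \<le> b * dist ((f \<circ> old) x) ((f \<circ> old) y)"
      "b * dist ((f \<circ> old) x) ((f \<circ> old) y) \<le> B * gdist ?H x y"
      using lower[OF V] upper[OF V] gdist_K2_step_old[OF n H xy(1,2)] by simp_all
  qed
  then obtain e where e: "e \<in> arcs ?H"
    "(1 / 2) ^ k * (real k * ?\<delta>) \<le> b * dist (f (old (tail ?H e))) (f (old (head ?H e)))"
    by auto
  obtain a where a: "a \<in> arcs (K2_step n ?H)"
    "(b * dist (f (old (tail ?H e))) (f (old (head ?H e))) + (1 / 2) ^ k * ?\<delta>) / 2 \<le>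
      b * dist (f (tail (K2_step n ?H) a)) (f (head (K2_step n ?H) a))"
    using K2_step_steeper_arc[OF n H len_power[OF n] e(1) assms(2,3) lower upper] by blast
  have "(1 / 2) ^ Suc k * (real (Suc k) * ?\<delta>) = ((1 / 2) ^ k * (real k * ?\<delta>) + (1 / 2) ^ k * ?\<delta>) / 2"
    by (simp add: distrib_left distrib_right)
  also have "\<dots> \<le> b * dist (f (tail (K2_step n ?H) a)) (f (head (K2_step n ?H) a))"
    by (rule order_trans[OF divide_right_mono[OF add_right_mono[OF e(2)]] a(2)]) simp
  finally show ?case
    unfolding S using a(1) by blast
qed

section \<open>Distortion under restriction, and its translation into real inequalities\<close>

text \<open>Both suprema for the restricted map run over fewer pairs with the same quotients. If
  \<open>f\<close> is not injective on \<open>Y\<close>, the right side is infinite.\<close>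

lemma distortion_restrict:
  assumes "inj_on \<iota> X" "\<iota> ` X \<subseteq> Y"
    and iso: "\<And>x y. x \<in> X \<Longrightarrow> y \<in> X \<Longrightarrow> d' (\<iota> x) (\<iota> y) = d x y"
  shows "distortion X d (f \<circ> \<iota>) \<le> distortion Y d' f"
proof (cases "inj_on f Y")
  case True
  then have inj: "inj_on (f \<circ> \<iota>) X"
    using assms(1,2) by (meson comp_inj_on inj_on_subset)
  have "lip_norm X d dist (f \<circ> \<iota>) \<le> lip_norm Y d' dist f"
    unfolding lip_norm_def
  proof (rule SUP_least, clarify)
    fix x y assume "x \<in> X" "y \<in> X" "x \<noteq> y"
    with assms show "ennreal (dist ((f \<circ> \<iota>) x) ((f \<circ> \<iota>) y) / d x y) \<le>
      (SUP (x, y)\<in>{(x, y). x \<in> Y \<and> y \<in> Y \<and> x \<noteq> y}. ennreal (dist (f x) (f y) / d' x y))"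
      by (intro SUP_upper2[of "(\<iota> x, \<iota> y)"]) (auto dest: inj_onD)
  qed
  moreover have "lip_norm ((f \<circ> \<iota>) ` X) dist d (inv_into X (f \<circ> \<iota>)) \<le>
      lip_norm (f ` Y) dist d' (inv_into Y f)"
    unfolding lip_norm_def
  proof (rule SUP_least, clarify)
    fix x y assume xy: "x \<in> X" "y \<in> X" "(f \<circ> \<iota>) x \<noteq> (f \<circ> \<iota>) y"
    then have "inv_into Y f (f (\<iota> x)) = \<iota> x" "inv_into Y f (f (\<iota> y)) = \<iota> y"
      using assms(2) True by (auto intro!: inv_into_f_f)
    moreover have "inv_into X (f \<circ> \<iota>) ((f \<circ> \<iota>) x) = x" "inv_into X (f \<circ> \<iota>) ((f \<circ> \<iota>) y) = y"
      using xy inj by (auto intro!: inv_into_f_f simp del: comp_apply)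
    ultimately show "ennreal (d (inv_into X (f \<circ> \<iota>) ((f \<circ> \<iota>) x)) (inv_into X (f \<circ> \<iota>) ((f \<circ> \<iota>) y)) /
        dist ((f \<circ> \<iota>) x) ((f \<circ> \<iota>) y)) \<le>
      (SUP (x, y)\<in>{(x, y). x \<in> f ` Y \<and> y \<in> f ` Y \<and> x \<noteq> y}.
        ennreal (d' (inv_into Y f x) (inv_into Y f y) / dist x y))"
      using xy assms(2) by (intro SUP_upper2[of "(f (\<iota> x), f (\<iota> y))"]) (auto simp: iso)
  qed
  ultimately show ?thesis
    using True inj by (simp add: distortion_def mult_mono)
qed (simp add: distortion_def)

lemma c1_mono:
  assumes "inj_on \<iota> X" "\<iota> ` X \<subseteq> Y"
    and "\<And>x y. x \<in> X \<Longrightarrow> y \<in> X \<Longrightarrow> d' (\<iota> x) (\<iota> y) = d x y"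
  shows "c1 X d \<le> c1 (Y :: 'b set) d'"
proof -
  have "c1 X d \<le> distortion Y d' f" for f :: "'b \<Rightarrow> L1"
    unfolding c1_def
    by (rule INF_lower2[OF UNIV_I], rule distortion_restrict[where \<iota> = \<iota>]) (use assms in auto)
  then show ?thesis
    unfolding c1_def[of Y] by (intro INF_greatest)
qed

text \<open>The scale \<open>b\<close> is the Lipschitz norm of the inverse, so multiplying the
  \<open>L1\<close> distances by \<open>b\<close> makes the map noncontracting.\<close>

lemma distortion_less_bounds:
  assumes less: "distortion X d f < ennreal B"
    and pos: "\<And>x y. x \<in> X \<Longrightarrow> y \<in> X \<Longrightarrow> x \<noteq> y \<Longrightarrow> 0 < d x y"
    and ex: "x0 \<in> X" "y0 \<in> X" "x0 \<noteq> y0"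
  obtains b where "0 < b"
    "\<And>x y. x \<in> X \<Longrightarrow> y \<in> X \<Longrightarrow> x \<noteq> y \<Longrightarrow> d x y \<le> b * dist (f x) (f y)"
    "\<And>x y. x \<in> X \<Longrightarrow> y \<in> X \<Longrightarrow> x \<noteq> y \<Longrightarrow> b * dist (f x) (f y) \<le> B * d x y"
proof -
  have inj: "inj_on f X"
    using less by (auto simp: distortion_def split: if_splits)
  define p q where "p = lip_norm X d dist f" and "q = lip_norm (f ` X) dist d (inv_into X f)"
  have pq: "p * q < ennreal B"
    using less inj by (simp add: distortion_def p_def q_def)
  have dist_pos: "0 < dist (f x) (f y)" if "x \<in> X" "y \<in> X" "x \<noteq> y" for x y
    using inj that by (auto dest: inj_onD)
  have p: "ennreal (dist (f x) (f y) / d x y) \<le> p" if "x \<in> X" "y \<in> X" "x \<noteq> y" for x y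
    unfolding p_def lip_norm_def using that by (intro SUP_upper2[of "(x, y)"]) auto
  have q: "ennreal (d x y / dist (f x) (f y)) \<le> q" if "x \<in> X" "y \<in> X" "x \<noteq> y" for x y
    unfolding q_def lip_norm_def using that inj
    by (intro SUP_upper2[of "(f x, f y)"]) (auto dest: inj_onD)
  have "0 < ennreal (dist (f x0) (f y0) / d x0 y0)" "0 < ennreal (d x0 y0 / dist (f x0) (f y0))"
    using dist_pos[OF ex] pos[OF ex] by (auto simp: ennreal_less_zero_iff)
  then have pq0: "0 < p" "0 < q"
    using less_le_trans[OF _ p[OF ex]] less_le_trans[OF _ q[OF ex]] by blast+
  \<comment> \<open>In \<open>ennreal\<close> the product of 0 and \<open>top\<close> is 0, so
    finiteness of \<open>p * q\<close> passes to the factors only because both are positive, which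
    the pair \<open>x0\<close>, \<open>y0\<close> guarantees.\<close>
  have "p \<noteq> top" "q \<noteq> top"
    using pq pq0[THEN less_imp_neq, symmetric] by (auto simp: ennreal_mult_top ennreal_top_mult)
  then obtain a b where ab: "p = ennreal a" "0 \<le> a" "q = ennreal b" "0 \<le> b"
    by (metis ennreal_cases)
  have "0 < b" using pq0 ab by (simp add: ennreal_less_zero_iff)
  have "a * b < B"
    using pq ab by (simp add: ennreal_less_iff flip: ennreal_mult)
  show thesis
  proof (rule that[OF \<open>0 < b\<close>])
    fix x y assume xy: "x \<in> X" "y \<in> X" "x \<noteq> y"
    show "d x y \<le> b * dist (f x) (f y)"
      using q[OF xy] ab dist_pos[OF xy] by (simp add: pos_divide_le_eq)
    have "dist (f x) (f y) \<le> a * d x y"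
      using p[OF xy] ab pos[OF xy] by (simp add: pos_divide_le_eq)
    then have "b * dist (f x) (f y) \<le> (a * b) * d x y"
      using \<open>0 < b\<close> by (simp add: mult.assoc mult.left_commute)
    also have "\<dots> \<le> B * d x y"
      using \<open>a * b < B\<close> pos[OF xy] by (intro mult_right_mono) auto
    finally show "b * dist (f x) (f y) \<le> B * d x y" .
  qed
qed

section \<open>Convergence and the bound on the limit\<close>

lemma src_snk_oslash_power:
  "src (oslash_power (K2 n) k) \<in> verts (oslash_power (K2 n) k)"
  "snk (oslash_power (K2 n) k) \<in> verts (oslash_power (K2 n) k)"
  "src (oslash_power (K2 n) k) \<noteq> snk (oslash_power (K2 n) k)"
  by (induct k) (auto simp: unit_edge_def nat_labelled_def oslash_def)

lemma c1_oslash_power_mono: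
  assumes "n \<ge> 1"
  shows "incseq (\<lambda>k. c1 (verts (oslash_power (K2 n) k)) (gdist (oslash_power (K2 n) k)))"
proof (rule incseq_SucI)
  fix k
  let ?H = "oslash_power (K2 n) k"
  have "oslash_power (K2 n) (Suc k) = K2_step n ?H"
    by (simp add: K2_step_def)
  then show "c1 (verts ?H) (gdist ?H) \<le>
      c1 (verts (oslash_power (K2 n) (Suc k))) (gdist (oslash_power (K2 n) (Suc k)))"
    using gdist_K2_step_old[OF assms connected_oslash_power[OF assms]]
    by (auto intro!: c1_mono[of old] simp: inj_on_def verts_K2_step)
qed

theorem theorem4p4:
  fixes n :: nat
  assumes "n \<ge> 2"
  shows "\<exists>L. (\<lambda>k. c1 (verts (oslash_power (K2 n) k)) (gdist (oslash_power (K2 n) k)))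
               \<longlonglongrightarrow> L
           \<and> L \<ge> ennreal (2 - 2 / real n)"
proof (intro exI conjI)
  have n: "n \<ge> 1" using assms by simp
  let ?c = "\<lambda>k. c1 (verts (oslash_power (K2 n) k)) (gdist (oslash_power (K2 n) k))"
  show "?c \<longlonglongrightarrow> (SUP k. ?c k)"
    by (rule LIMSEQ_SUP[OF c1_oslash_power_mono[OF n]])
  show "ennreal (2 - 2 / real n) \<le> (SUP k. ?c k)"
  proof (rule ccontr)
    assume "\<not> ?thesis"
    \<comment> \<open>Strictness on the left yields a map of distortion below \<open>B'\<close> even
      if the infimum is not attained; strictness on the right yields
      \<open>\<delta> > 0\<close>.\<close>
    then obtain B' where B': "(SUP k. ?c k) < B'" "B' < ennreal (2 - 2 / real n)"
      by (meson dense not_le)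
    then obtain B where B: "B' = ennreal B" "0 \<le> B"
      by (cases B') auto
    define \<delta> where "\<delta> = 1 - 1 / n - B / 2"
    have "B < 2 - 2 / n"
      using B' B by (simp add: ennreal_less_iff)
    then have "\<delta> > 0"
      by (simp add: \<delta>_def field_simps)
    \<comment> \<open>After this many levels the accumulated gain exceeds the largest stretch
      allowed.\<close>
    obtain k :: nat where k: "B < real k * \<delta>"
      using reals_Archimedean3[OF \<open>\<delta> > 0\<close>] by blast
    let ?G = "oslash_power (K2 n) k"
    interpret G: connected_st_graph ?G
      by (rule connected_oslash_power[OF n])
    have "?c k < ennreal B"
      using le_less_trans[OF SUP_upper[OF UNIV_I] B'(1)] unfolding B(1) .
    then obtain f :: "nat \<Rightarrow> L1" where f: "distortion (verts ?G) (gdist ?G) f < ennreal B"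
      by (auto simp: c1_def INF_less_iff)
    have pos: "0 < gdist ?G x y" if "x \<in> verts ?G" "y \<in> verts ?G" "x \<noteq> y" for x y
    proof -
      have "0 < (1 / 2 :: real) ^ k" by simp
      also have "\<dots> \<le> gdist ?G x y"
        using len_power[OF n] that by (intro G.min_len_le_gdist) auto
      finally show ?thesis .
    qed
    obtain b where b: "0 < b"
      "\<And>x y. x \<in> verts ?G \<Longrightarrow> y \<in> verts ?G \<Longrightarrow> x \<noteq> y \<Longrightarrow> gdist ?G x y \<le> b * dist (f x) (f y)"
      "\<And>x y. x \<in> verts ?G \<Longrightarrow> y \<in> verts ?G \<Longrightarrow> x \<noteq> y \<Longrightarrow> b * dist (f x) (f y) \<le> B * gdist ?G x y"
      using distortion_less_bounds[OF f pos src_snk_oslash_power[of n k]] by blast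
    obtain a where a: "a \<in> arcs ?G"
      "(1 / 2) ^ k * (real k * \<delta>) \<le> b * dist (f (tail ?G a)) (f (head ?G a))"
      using oslash_power_steep_arc[OF n B(2) less_imp_le[OF b(1)] b(2,3)] unfolding \<delta>_def by blast
    \<comment> \<open>The distortion bound caps the stretch of the edge \<open>a\<close> at
      \<open>B\<close>, against the stretch of at least \<open>k * \<delta>\<close> just
      found.\<close>
    have bound: "b * dist (f (tail ?G a)) (f (head ?G a)) \<le> B * (1 / 2) ^ k"
    proof (cases "tail ?G a = head ?G a")
      case True
      then show ?thesis using B(2) by simp
    next
      case False
      then have "b * dist (f (tail ?G a)) (f (head ?G a)) \<le> B * gdist ?G (tail ?G a) (head ?G a)"
        using a(1) G.tail_in_vertices G.head_in_vertices by (intro b(3)) auto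
      also have "\<dots> \<le> B * (1 / 2) ^ k"
        using G.gdist_arc_le[OF a(1)] len_power[OF n a(1)] B(2) by (intro mult_left_mono) auto
      finally show ?thesis .
    qed
    have "(1 / 2) ^ k * (real k * \<delta>) \<le> (1 / 2) ^ k * B"
      using order_trans[OF a(2) bound] by (simp only: mult.commute[of B])
    with k show False by simp
  qed
qed

end
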